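(* For any finite simple graphs $G$ and $H$ of orders $n_1$ and $n_2$ respectively, $$\gamma_R(G\Box H)\le 2\gamma(G)\gamma(H)+(n_1-\gamma(G))(n_2-\gamma(H)).$$
   Context: $\gamma(X)$ denotes the domination number of a graph $X$ (minimum size of a set $D$ such that every vertex outside $D$ has a neighbor in $D$). A Roman dominating function on $X$ is a map $f:V(X)\to\{0,1,2\}$ such that every vertex $v$ with $f(v)=0$ has a neighbor $u$ with $f(u)=2$; $\gamma_R(X)$ is the minimum of $\sum_v f(v)$ over such $f$. The Cartesian product $G\Box H$ has vertex set $V(G)\times V(H)$, with $(g,h)\sim(g',h')$ iff ($g=g'$ and $h\sim h'$) or ($g\sim g'$ and $h=h'$). *)

theory Defs
  imports "Graph_Theory.Pair_Digraph"
begin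

text \<open>
  Finite simple graphs are the structures satisfying \<^locale>\<open>pair_graph\<close>: a finite vertex set
  with a finite, symmetric, irreflexive set of arcs between vertices. The edge
  between \<open>u\<close> and \<open>v\<close> is represented by the two arcs \<open>(u, v)\<close> and \<open>(v, u)\<close>.
\<close>

definition dominating_set :: "'a pair_pre_digraph \<Rightarrow> 'a set \<Rightarrow> bool" where
  "dominating_set X D \<longleftrightarrow>
     D \<subseteq> pverts X \<and> (\<forall>v \<in> pverts X - D. \<exists>u \<in> D. (v, u) \<in> parcs X)"

definition domination_number :: "'a pair_pre_digraph \<Rightarrow> nat" where
  "domination_number X = (LEAST k. \<exists>D. dominating_set X D \<and> card D = k)"

text \<open>
  A map on the vertices is a total HOL function whose values outside the vertex set are
  unconstrained; they enter neither the condition nor the weight.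
\<close>

definition roman_dominating :: "'a pair_pre_digraph \<Rightarrow> ('a \<Rightarrow> nat) \<Rightarrow> bool" where
  "roman_dominating X f \<longleftrightarrow>
     f ` pverts X \<subseteq> {0, 1, 2} \<and>
     (\<forall>v \<in> pverts X. f v = 0 \<longrightarrow> (\<exists>u \<in> pverts X. (v, u) \<in> parcs X \<and> f u = 2))"

definition roman_domination_number :: "'a pair_pre_digraph \<Rightarrow> nat" where
  "roman_domination_number X =
     (LEAST k. \<exists>f. roman_dominating X f \<and> (\<Sum>v \<in> pverts X. f v) = k)"

definition cartesian_product ::
  "'a pair_pre_digraph \<Rightarrow> 'b pair_pre_digraph \<Rightarrow> ('a \<times> 'b) pair_pre_digraph"
  (infixr \<open>\<box>\<close> 75) where
  "G \<box> H = \<lparr> pverts = pverts G \<times> pverts H,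
     parcs = {((g, h), (g', h')) | g h g' h'.
       (g = g' \<and> g \<in> pverts G \<and> (h, h') \<in> parcs H) \<or>
       ((g, g') \<in> parcs G \<and> h = h' \<and> h \<in> pverts H)} \<rparr>"

lemma pair_graph_cartesian_product:
  assumes "pair_graph G" and "pair_graph H"
  shows "pair_graph (G \<box> H)"
proof -
  interpret G: pair_graph G by fact
  interpret H: pair_graph H by fact
  have sub: "parcs (G \<box> H) \<subseteq> (pverts G \<times> pverts H) \<times> (pverts G \<times> pverts H)"
    by (auto simp: cartesian_product_def dest: G.wellformed' H.wellformed')
  have symG: "sym (parcs G)" and symH: "sym (parcs H)"
    using G.pair_sym_arcs H.pair_sym_arcs by (simp_all add: symmetric_def)
  show ?thesis
  proof unfold_locales
    show "finite (parcs (G \<box> H))"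
      using sub by (rule finite_subset) simp
    show "symmetric (with_proj (G \<box> H))"
      using symG symH by (auto simp: symmetric_def sym_def cartesian_product_def)
  qed (auto simp: cartesian_product_def dest: G.wellformed' H.wellformed' G.no_loops' H.no_loops')
qed

lemma domination_number_attained:
  "\<exists>D. dominating_set X D \<and> card D = domination_number X"
  unfolding domination_number_def
  by (rule LeastI[where k = "card (pverts X)"])
    (auto simp: dominating_set_def intro!: exI[of _ "pverts X"])

lemma domination_number_le_order: "domination_number X \<le> card (pverts X)"
  unfolding domination_number_def
  by (rule Least_le) (auto simp: dominating_set_def intro!: exI[of _ "pverts X"])

lemma roman_domination_number_attained:
  "\<exists>f. roman_dominating X f \<and> (\<Sum>v \<in> pverts X. f v) = roman_domination_number X"
  unfolding roman_domination_number_def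
  by (rule LeastI[where k = "\<Sum>v \<in> pverts X. 2"])
    (auto simp: roman_dominating_def intro!: exI[of _ "\<lambda>_. 2"])

end

theory Submission
  imports Defs
begin

text \<open>
  For dominating sets \<open>D\<close> of \<open>G\<close> and \<open>E\<close> of \<open>H\<close>, put weight 2 on \<open>D \<times> E\<close>, weight 1 where both
  coordinates lie outside, and weight 0 elsewhere. A vertex of weight 0 has exactly one
  coordinate outside its dominating set; moving that coordinate into the set along an edge
  reaches \<open>D \<times> E\<close>.
\<close>

lemma roman_domination_number_le:
  assumes "roman_dominating X f"
  shows "roman_domination_number X \<le> (\<Sum>v \<in> pverts X. f v)"
  unfolding roman_domination_number_def using assms by (auto intro: Least_le)

text \<open>Each term is a product of an indicator in \<open>g\<close> and one in \<open>h\<close>,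
  so that sums over a product set factor. The two terms are never both nonzero.\<close>

definition product_weight :: "'a set \<Rightarrow> 'b set \<Rightarrow> 'a \<times> 'b \<Rightarrow> nat" where
  "product_weight D E = (\<lambda>(g, h).
     2 * (of_bool (g \<in> D) * of_bool (h \<in> E)) + of_bool (g \<notin> D) * of_bool (h \<notin> E))"

lemma sum_product_weight:
  assumes "finite A" and "finite B" and "D \<subseteq> A" and "E \<subseteq> B"
  shows "sum (product_weight D E) (A \<times> B) =
    2 * (card D * card E) + card (A - D) * card (B - E)"
proof -
  \<comment> \<open>After factoring, \<open>sum_of_bool_eq\<close> evaluates each sum of indicators
    as the size of one of these intersections.\<close>
  have "A \<inter> {x. x \<in> D} = D" "B \<inter> {x. x \<in> E} = E"
    "A \<inter> {x. x \<notin> D} = A - D" "B \<inter> {x. x \<notin> E} = B - E"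
    using assms by auto
  then show ?thesis
    using assms
    by (simp add: product_weight_def sum.distrib sum_distrib_left[symmetric]
        sum_distrib_right[symmetric] sum.cartesian_product[symmetric] sum_of_bool_eq
        del: of_bool_not_iff sum_mult_of_bool_eq sum_of_bool_mult_eq)
qed

lemma roman_dominating_product_weight:
  assumes D: "dominating_set G D" and E: "dominating_set H E"
  shows "roman_dominating (G \<box> H) (product_weight D E)"
  unfolding roman_dominating_def
proof (intro conjI ballI impI)
  show "product_weight D E ` pverts (G \<box> H) \<subseteq> {0, 1, 2}"
    by (auto simp: product_weight_def of_bool_def split: if_splits)
next
  fix v assume v: "v \<in> pverts (G \<box> H)" and zero: "product_weight D E v = 0"
  obtain g h where gh: "v = (g, h)" by force
  have g: "g \<in> pverts G" and h: "h \<in> pverts H"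
    using v gh by (auto simp: cartesian_product_def)
  consider "g \<in> D" "h \<notin> E" | "g \<notin> D" "h \<in> E"
    using zero gh by (auto simp: product_weight_def split: if_splits)
  \<comment> \<open>The coordinate already inside its set is kept. The disjunction has the shape of
    adjacency in \<open>G \<box> H\<close>, so both cases end the same way.\<close>
  then obtain g' h' where "g' \<in> D" "h' \<in> E"
    and "g = g' \<and> (h, h') \<in> parcs H \<or> (g, g') \<in> parcs G \<and> h = h'"
    using g h D E unfolding dominating_set_def by (metis DiffI)
  moreover have "(g', h') \<in> pverts (G \<box> H)"
    using calculation D E by (auto simp: dominating_set_def cartesian_product_def)
  ultimately show "\<exists>u \<in> pverts (G \<box> H). (v, u) \<in> parcs (G \<box> H) \<and> product_weight D E u = 2"
    using g h gh
    by (intro bexI[of _ "(g', h')"]) (auto simp: cartesian_product_def product_weight_def)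
qed

theorem theorem17:
  fixes G :: "'a pair_pre_digraph" and H :: "'b pair_pre_digraph"
    and n\<^sub>1 n\<^sub>2 :: nat
  assumes "pair_graph G" and "pair_graph H"
    and "card (pverts G) = n\<^sub>1" and "card (pverts H) = n\<^sub>2"
  shows "int (roman_domination_number (G \<box> H)) \<le>
    2 * int (domination_number G) * int (domination_number H) +
    (int n\<^sub>1 - int (domination_number G)) * (int n\<^sub>2 - int (domination_number H))"
proof -
  interpret G: pair_graph G by fact
  interpret H: pair_graph H by fact
  \<comment> \<open>Taking \<open>D\<close> and \<open>E\<close> of minimum size makes the weight
    equal to the right-hand side.\<close>
  obtain D where D: "dominating_set G D" "card D = domination_number G"
    using domination_number_attained by blast
  obtain E where E: "dominating_set H E" "card E = domination_number H"
    using domination_number_attained by blast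
  have sub: "D \<subseteq> pverts G" "E \<subseteq> pverts H"
    using D E by (auto simp: dominating_set_def)
  \<comment> \<open>A domination number is at most the order, so truncated subtraction on
    \<open>nat\<close> agrees with subtraction on \<open>int\<close> here.\<close>
  have compl: "int (card (pverts G - D)) = int n\<^sub>1 - int (domination_number G)"
    "int (card (pverts H - E)) = int n\<^sub>2 - int (domination_number H)"
    using sub D(2) E(2) assms(3,4) domination_number_le_order[of G] domination_number_le_order[of H]
    by (auto simp: card_Diff_subset finite_subset of_nat_diff)
  have "roman_domination_number (G \<box> H) \<le> sum (product_weight D E) (pverts G \<times> pverts H)"
    using roman_domination_number_le[OF roman_dominating_product_weight[OF D(1) E(1)]]
    by (simp add: cartesian_product_def)
  also have "\<dots> = 2 * (card D * card E) + card (pverts G - D) * card (pverts H - E)"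
    using sub by (simp add: sum_product_weight)
  finally have "int (roman_domination_number (G \<box> H)) \<le>
    int (2 * (card D * card E) + card (pverts G - D) * card (pverts H - E))"
    by (simp only: of_nat_le_iff)
  then show ?thesis
    by (simp add: compl D(2) E(2))
qed

end
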